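(* Let $\kappa,\lambda\in(0,1)$ with $\kappa^2+\lambda^2=1$, and let $\theta\in(0,\pi/6)$ be the angle with $\lambda=\cos 3\theta$ (equivalently $\kappa=\sin 3\theta$). Let $M>0$ be defined by $M^2=2\sqrt3\,\cos^2(\theta+\pi/6)\cos(2\theta-\pi/6)$. The fundamental period $2K$ of $\mathrm{dn}_3$ is given by $$2K=\frac{3\pi}{2M}\,F(\tfrac12,\tfrac12;1;k^2)$$ where $$k^2=\frac{\sin^2\theta\,\sin 2\theta}{\cos^2(\theta+\pi/6)\cos(2\theta-\pi/6)}.$$
   Context: $F(a,b;c;z)$ is the Gauss hypergeometric function ${}_2F_1$. Let $\phi$ be the analytic local inverse near $0$, with $\phi(0)=0$, of $f(T)=\int_0^T F(\tfrac13,\tfrac23;\tfrac12;\kappa^2\sin^2 t)\,dt$. The function $\mathrm{dn}_3$ is defined near $0$ by $\mathrm{dn}_3=\phi'$; it extends (uniquely) to an elliptic function on $\mathbb{C}$, also denoted $\mathrm{dn}_3$, namely $$\mathrm{dn}_3=1-\frac{\frac49\kappa^2}{\frac13+\wp},$$ where $\wp$ is the Weierstrass function (satisfying $(\wp')^2=4\wp^3-g_2\wp-g_3$, with a double pole at $0$) with invariants $g_2=\frac{4}{27}(1+8\lambda^2)$ and $g_3=\frac{8}{729}(8\lambda^4+20\lambda^2-1)$. The invariants are real and $g_2^3-27g_3^2>0$, so the period lattice of $\wp$ (which is also that of $\mathrm{dn}_3$) is rectangular: it is $\{2mK+2n\,\mathrm{i}K' : m,n\in\mathbb{Z}\}$ with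 $K>0$ and $K'>0$, which defines $K$ and $K'$. The constant $M$ arises as $M=\tfrac12\sqrt{(1+x_2)(x_3+x_1)}$, where $x_1\in(0,1)$, $-x_2\in(-2,0)$, $-x_3\in(-3,-2)$ are the three zeros of $x^3+3x^2-4\lambda^2$; this equals the expression in terms of $\theta$ used in the claim. *)

theory Defs
  imports "HOL-Complex_Analysis.Complex_Analysis"
begin

text \<open>
  The Gauss hypergeometric series; it is only meaningful for \<open>norm z < 1\<close>, and all arguments
  used below lie in that disc.
\<close>
definition hyp2F1 :: "'a \<Rightarrow> 'a \<Rightarrow> 'a \<Rightarrow> 'a \<Rightarrow> 'a :: {banach, real_normed_field}" where
  "hyp2F1 a b c z = eval_fps (fps_hypergeo [a, b] [c] 1) z"

lemma hyp2F1_altdef: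
  "hyp2F1 a b c z = (\<Sum>n. pochhammer a n * pochhammer b n / (pochhammer c n * fact n) * z ^ n)"
  by (simp add: hyp2F1_def eval_fps_def)

text \<open>Only the germ of this function at \<open>0\<close> matters, so the straight path from \<open>0\<close> to \<open>T\<close> is harmless.\<close>
definition hyp_sin_integral :: "real \<Rightarrow> complex \<Rightarrow> complex" where
  "hyp_sin_integral \<kappa> T =
     contour_integral (linepath 0 T) (\<lambda>t. hyp2F1 (1/3) (2/3) (1/2) (of_real (\<kappa>\<^sup>2) * sin t ^ 2))"

definition local_inverse_at_0 :: "(complex \<Rightarrow> complex) \<Rightarrow> (complex \<Rightarrow> complex) \<Rightarrow> bool" where
  "local_inverse_at_0 f \<phi> \<longleftrightarrow>
     \<phi> analytic_on {0} \<and> \<phi> 0 = 0 \<and>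
     (\<forall>\<^sub>F u in nhds 0. f (\<phi> u) = u) \<and> (\<forall>\<^sub>F T in nhds 0. \<phi> (f T) = T)"

definition periods :: "(complex \<Rightarrow> complex) \<Rightarrow> complex set" where
  "periods g = {\<omega>. \<forall>z. g (z + \<omega>) = g z}"

text \<open>
  Meromorphic functions are total functions here; \<open>nicely_meromorphic_on\<close> excludes removable
  singularities and fixes the value at a pole to be \<open>0\<close>, so that the pointwise equation in
  \<open>periods\<close> is equality of meromorphic functions.
\<close>
definition elliptic :: "(complex \<Rightarrow> complex) \<Rightarrow> bool" where
  "elliptic g \<longleftrightarrow> g nicely_meromorphic_on UNIV \<and>
     (\<exists>\<omega>1 \<in> periods g. \<exists>\<omega>2 \<in> periods g. \<omega>1 \<noteq> 0 \<and> \<omega>2 / \<omega>1 \<notin> \<real>)"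

text \<open>
  \<open>is_dn3 \<kappa> g\<close> determines \<open>g\<close> uniquely: two such functions have the same germ at \<open>0\<close>, hence agree
  by analytic continuation.
\<close>
definition is_dn3 :: "real \<Rightarrow> (complex \<Rightarrow> complex) \<Rightarrow> bool" where
  "is_dn3 \<kappa> g \<longleftrightarrow> elliptic g \<and>
     (\<exists>\<phi>. local_inverse_at_0 (hyp_sin_integral \<kappa>) \<phi> \<and> (\<forall>\<^sub>F u in nhds 0. g u = deriv \<phi> u))"

end

theory Submission
  imports Defs
begin

text \<open>
  Since \<open>F(1/3, 2/3; 1/2; sin\<^sup>2 \<psi>) = cos (\<psi>/3) / cos \<psi>\<close>, putting \<open>sin \<psi> = \<kappa> sin \<phi>\<close> gives
  \<open>dn\<^sub>3 = cos \<psi> / cos (\<psi>/3) = 1 - 4 sin\<^sup>2 (\<psi>/3)\<close>, and \<open>x = dn\<^sub>3\<close> satisfies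
  \<open>x'\<^sup>2 = (4/9) (1 - x) (x\<^sup>3 + 3 x\<^sup>2 - 4 \<lambda>\<^sup>2) = (4/9) (1 - x) (x - b) (x - c) (x - d)\<close>.
  Legendre's substitution, which makes \<open>x\<close> a Moebius transform of \<open>sin\<^sup>2 t\<close> with \<open>x = 1\<close> at \<open>t = 0\<close>
  and \<open>x = b\<close> at \<open>t = \<pi>/2\<close>, turns the inverse of \<open>dn\<^sub>3\<close> into the elliptic integral
  \<open>u(t) = 3/(2M) \<integral>\<^sub>0\<^sup>t (1 - k\<^sup>2 sin\<^sup>2 s)\<^sup>-\<^sup>1\<^sup>/\<^sup>2 ds\<close>. The identity \<open>dn\<^sub>3 (u(t)) = x(t)\<close>
  holds near \<open>0\<close>; both sides continue meromorphically to a strip around the real axis, so it holds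
  for all real \<open>t\<close>. As \<open>u(t + \<pi>) = u(t) + u(\<pi>)\<close>, the number \<open>u(\<pi>)\<close> is a period, and it is the
  smallest positive one because \<open>x(t) = 1\<close> fails for \<open>0 < t < \<pi>\<close>. Integrating the binomial series
  termwise evaluates \<open>u(\<pi>)\<close>.
\<close>

section \<open>The Gauss hypergeometric series and its elementary values\<close>

lemma fps_conv_radius_hypergeo:
  fixes a b c :: "'a :: {banach, real_normed_field}"
  shows "fps_conv_radius (fps_hypergeo [a, b] [c] 1) \<ge> 1"
  unfolding fps_conv_radius_def
proof (rule conv_radius_geI_ex')
  fix r :: real assume r: "0 < r" "ereal r < 1"
  let ?h = "fps_hypergeo [a, b] [c] 1"
  \<comment> \<open>\<open>q n\<close> is the ratio of the norms of consecutive terms at radius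
    \<open>r\<close>. Dividing each linear factor by \<open>Suc n\<close> gives three quotients
    tending to 1, so \<open>q\<close> tends to \<open>r\<close> and the ratio test applies with any
    \<open>t\<close> strictly between \<open>r\<close> and 1.\<close>
  define q where "q n = norm ((a + of_nat n) * (b + of_nat n) / (of_nat (Suc n) * (c + of_nat n))) * r" for n
  have L: "(\<lambda>n. (x + of_nat n) / of_nat (Suc n)) \<longlonglongrightarrow> 1" for x :: 'a
  proof -
    have "(\<lambda>n. 1 + (x - 1) * inverse (of_nat (Suc n))) \<longlonglongrightarrow> 1 + (x - 1) * 0"
      by (intro tendsto_intros LIMSEQ_Suc lim_inverse_n)
    moreover have "1 + (x - 1) * inverse (of_nat (Suc n)) = (x + of_nat n) / of_nat (Suc n)" for n
      by (simp add: field_simps del: of_nat_Suc) (simp add: algebra_simps)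
    ultimately show ?thesis by (simp only:) simp
  qed
  have "(\<lambda>n. norm ((a + of_nat n) / of_nat (Suc n) * ((b + of_nat n) / of_nat (Suc n)) / ((c + of_nat n) / of_nat (Suc n))) * r)
    \<longlonglongrightarrow> norm (1 * 1 / 1 :: 'a) * r"
    by (intro tendsto_intros L) auto
  moreover have "(a + of_nat n) / of_nat (Suc n) * ((b + of_nat n) / of_nat (Suc n)) / ((c + of_nat n) / of_nat (Suc n))
     = (a + of_nat n) * (b + of_nat n) / (of_nat (Suc n) * (c + of_nat n))" for n
    by (simp add: divide_simps del: of_nat_Suc)
  ultimately have "q \<longlonglongrightarrow> r" by (simp add: q_def [abs_def])
  moreover obtain t where t: "r < t" "t < 1" using r dense[of r 1] by auto
  ultimately have "eventually (\<lambda>n. q n < t) sequentially" by (auto dest: order_tendstoD)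
  then obtain N where N: "\<And>n. n \<ge> N \<Longrightarrow> q n < t" by (auto simp: eventually_at_top_linorder)
  show "summable (\<lambda>n. fps_nth ?h n * of_real r ^ n)"
  proof (rule summable_ratio_test[OF t(2)])
    fix n assume "n \<ge> N"
    from less_imp_le[OF N[OF this]]
    have "q n * norm (fps_nth ?h n * of_real r ^ n) \<le> t * norm (fps_nth ?h n * of_real r ^ n)"
      by (rule mult_right_mono) simp
    moreover have "norm (fps_nth ?h (Suc n) * of_real r ^ Suc n) = q n * norm (fps_nth ?h n * of_real r ^ n)"
      using r by (simp add: fps_hypergeo_rec q_def norm_mult norm_divide norm_power del: fps_hypergeo_nth of_nat_Suc)
    ultimately show "norm (fps_nth ?h (Suc n) * of_real r ^ Suc n) \<le> t * norm (fps_nth ?h n * of_real r ^ n)"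
      by simp
  qed
qed

text \<open>The coefficient of X^n in this equation is exactly the two-term recurrence for the
  hypergeometric coefficients, cleared of the denominator that the assumption keeps nonzero.\<close>

lemma fps_hypergeo_ode:
  fixes a b c :: "'a :: field_char_0"
  assumes "\<And>n. c + of_nat n \<noteq> 0"
  defines "H \<equiv> fps_hypergeo [a, b] [c] 1"
  shows "(fps_X - fps_X ^ 2) * fps_deriv (fps_deriv H) +
           (fps_const c - fps_const (a + b + 1) * fps_X) * fps_deriv H = fps_const (a * b) * H"
proof (rule fps_ext)
  fix n
  have rec: "of_nat (Suc n) * (c + of_nat n) * fps_nth H (Suc n) = (a + of_nat n) * (b + of_nat n) * fps_nth H n" for n
    using assms(1)[of n] unfolding H_def fps_hypergeo_rec
    by (simp add: divide_simps del: fps_hypergeo_nth of_nat_Suc)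
  show "fps_nth ((fps_X - fps_X ^ 2) * fps_deriv (fps_deriv H) +
           (fps_const c - fps_const (a + b + 1) * fps_X) * fps_deriv H) n = fps_nth (fps_const (a * b) * H) n"
  proof (cases n)
    case 0
    then show ?thesis using rec[of 0]
      by (simp add: algebra_simps power2_eq_square)
  next
    case (Suc m)
    then show ?thesis using rec[of n]
      by (cases m) (simp_all add: algebra_simps power2_eq_square)
  qed
qed

lemma hyp2F1_of_real:
  fixes a b c z :: real
  assumes "\<bar>z\<bar> < 1"
  shows "hyp2F1 (of_real a) (of_real b) (of_real c) (of_real z) =
    (of_real (hyp2F1 a b c z) :: 'a :: {banach, real_normed_field})"
proof -
  have "summable (\<lambda>n. fps_nth (fps_hypergeo [a, b] [c] 1) n * z ^ n)"
    by (rule summable_fps, rule less_le_trans[OF _ fps_conv_radius_hypergeo]) (use assms in simp)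
  thus ?thesis
    unfolding hyp2F1_def eval_fps_def by (subst suminf_of_real) (auto simp: pochhammer_of_real)
qed

text \<open>Under z = sin^2 t the hypergeometric equation becomes y'' = -(2a)^2 y for y = cos t *
  F(sin^2 t), with y(0) = 1 and y'(0) = 0. With a nonzero, a vanishing energy forces y = cos (2 a
  t).\<close>

lemma hyp2F1_sin_sq:
  fixes a x :: real
  assumes a: "a \<noteq> 0" and x: "\<bar>x\<bar> < pi / 2"
  shows "hyp2F1 (1/2 + a) (1/2 - a) (1/2) (sin x ^ 2) = cos (2 * a * x) / cos x"
proof -
  define H where "H = fps_hypergeo [1/2 + a, 1/2 - a] [1/2 :: real] 1"
  define F where "F = eval_fps H"
  define F1 where "F1 = eval_fps (fps_deriv H)"
  define F2 where "F2 = eval_fps (fps_deriv (fps_deriv H))"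
  have R0: "fps_conv_radius H \<ge> 1" unfolding H_def by (rule fps_conv_radius_hypergeo)
  have R1: "fps_conv_radius (fps_deriv H) \<ge> 1"
    using R0 fps_conv_radius_deriv[of H] by (rule order_trans)
  have R2: "fps_conv_radius (fps_deriv (fps_deriv H)) \<ge> 1"
    using R1 fps_conv_radius_deriv[of "fps_deriv H"] by (rule order_trans)
  have rad: "ereal \<bar>z\<bar> < fps_conv_radius G" if "\<bar>z\<bar> < 1" "fps_conv_radius G \<ge> 1" for z and G :: "real fps"
    by (rule less_le_trans[OF _ that(2)]) (use that(1) in simp)
  have dF: "(F has_real_derivative F1 z) (at z)" if "\<bar>z\<bar> < 1" for z
    unfolding F_def F1_def by (rule has_field_derivative_eval_fps) (use rad that R0 in auto)
  have dF1: "(F1 has_real_derivative F2 z) (at z)" if "\<bar>z\<bar> < 1" for z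
    unfolding F2_def F1_def by (rule has_field_derivative_eval_fps) (use rad that R1 in auto)
  \<comment> \<open>For parameters 1/2 + a and 1/2 - a, the sum plus one is 2 and the product is 1/4
    - a^2, which gives these coefficients.\<close>
  have ode: "(z - z^2) * F2 z + (1/2 - 2 * z) * F1 z = (1/4 - a^2) * F z" if z: "\<bar>z\<bar> < 1" for z
  proof -
    have nz: "1/2 + real n \<noteq> 0" for n by linarith
    have "eval_fps ((fps_X - fps_X ^ 2) * fps_deriv (fps_deriv H) +
           (fps_const (1/2) - fps_const (1/2 + a + (1/2 - a) + 1) * fps_X) * fps_deriv H) z =
          eval_fps (fps_const ((1/2 + a) * (1/2 - a)) * H) z"
      unfolding H_def by (subst fps_hypergeo_ode) (use nz in auto)
    moreover have "eval_fps ((fps_X - fps_X ^ 2) * fps_deriv (fps_deriv H)) z = (z - z^2) * F2 z"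
    proof -
      have "fps_conv_radius (fps_X - fps_X ^ 2 :: real fps) \<ge> \<infinity>"
        by (rule fps_conv_radius_diff_ge) auto
      thus ?thesis unfolding F2_def using rad[OF z R2]
        by (subst eval_fps_mult) (auto simp: eval_fps_diff)
    qed
    moreover have "eval_fps ((fps_const (1/2) - fps_const 2 * fps_X) * fps_deriv H) z = (1/2 - 2*z) * F1 z"
    proof -
      have "fps_conv_radius (fps_const 2 * fps_X :: real fps) \<ge> \<infinity>"
        by (rule fps_conv_radius_mult_ge) auto
      moreover from this have "fps_conv_radius (fps_const (1/2) - fps_const 2 * fps_X :: real fps) \<ge> \<infinity>"
        by (intro fps_conv_radius_diff_ge) auto
      ultimately show ?thesis unfolding F1_def using rad[OF z R1]
        by (subst eval_fps_mult) (auto simp: eval_fps_diff eval_fps_mult)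
    qed
    moreover have "eval_fps (fps_const ((1/2 + a) * (1/2 - a)) * H) z = (1/4 - a^2) * F z"
      unfolding F_def using rad[OF z R0]
      by (subst eval_fps_mult) (auto simp: field_simps power2_eq_square)
    moreover have "eval_fps ((fps_X - fps_X ^ 2) * fps_deriv (fps_deriv H) + (fps_const (1/2) - fps_const 2 * fps_X) * fps_deriv H) z
      = eval_fps ((fps_X - fps_X ^ 2) * fps_deriv (fps_deriv H)) z + eval_fps ((fps_const (1/2) - fps_const 2 * fps_X) * fps_deriv H) z"
      by (rule eval_fps_add; rule less_le_trans[of _ 1]; (intro fps_conv_radius_mult_ge fps_conv_radius_diff_ge)?)
         (use z R1 R2 in \<open>auto simp flip: one_ereal_def intro!: fps_conv_radius_mult_ge\<close>)
    ultimately show ?thesis by simp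
  qed
  define I where "I = {-(pi/2)<..<pi/2}"
  have cpos: "cos t > 0" and s1: "\<bar>(sin t)^2\<bar> < 1" if "t \<in> I" for t
  proof -
    show "cos t > 0" using that by (auto simp: I_def intro!: cos_gt_zero_pi)
    hence "(cos t)^2 > 0" by simp
    thus "\<bar>(sin t)^2\<bar> < 1" using sin_cos_squared_add[of t] by (simp only: abs_power2)
  qed
  define y where "y t = cos t * F ((sin t)^2)" for t
  define y1 where "y1 t = - sin t * F ((sin t)^2) + 2 * sin t * (cos t)^2 * F1 ((sin t)^2)" for t
  have dFs: "((\<lambda>t. F ((sin t)^2)) has_real_derivative F1 ((sin t)^2) * (2 * sin t * cos t)) (at t)" if "t \<in> I" for t
    by (rule DERIV_chain2[where f = F and g = "\<lambda>t. (sin t)^2", OF dF[OF s1[OF that]]]) (auto intro!: derivative_eq_intros)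
  have dF1s: "((\<lambda>t. F1 ((sin t)^2)) has_real_derivative F2 ((sin t)^2) * (2 * sin t * cos t)) (at t)" if "t \<in> I" for t
    by (rule DERIV_chain2[where f = F1 and g = "\<lambda>t. (sin t)^2", OF dF1[OF s1[OF that]]]) (auto intro!: derivative_eq_intros)
  have dy: "(y has_real_derivative y1 t) (at t)" if "t \<in> I" for t
    unfolding y_def[abs_def] y1_def
    by (rule derivative_eq_intros refl dFs[OF that])+ (simp add: power2_eq_square algebra_simps)
  have dy1: "(y1 has_real_derivative - ((2 * a)^2 * y t)) (at t)" if "t \<in> I" for t
  proof -
    let ?s = "(sin t)^2"
    have "(y1 has_real_derivative (- cos t * F ?s - sin t * (F1 ?s * (2 * sin t * cos t)) +
       ((2 * cos t * (cos t)^2 + 2 * sin t * (2 * cos t * (- sin t))) * F1 ?s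
         + 2 * sin t * (cos t)^2 * (F2 ?s * (2 * sin t * cos t))))) (at t)" (is "(_ has_real_derivative ?d) _")
      unfolding y1_def[abs_def]
      by (rule derivative_eq_intros refl dFs[OF that] dF1s[OF that])+ (simp add: algebra_simps)
    \<comment> \<open>Grouping isolates the left-hand side of \<open>ode\<close>; the leftover -F/4
      then cancels against the 1/4 in 1/4 - a^2, leaving only the multiple -4 a^2 of
      \<open>y\<close>.\<close>
    also have "?d = 4 * cos t * ((?s - ?s^2) * F2 ?s + (1/2 - 2 * ?s) * F1 ?s - F ?s / 4)"
    proof -
      have c2: "(cos t)^2 = 1 - ?s" by (rule cos_squared_eq)
      have "?d = cos t * (- F ?s - 2 * ?s * F1 ?s + (2 * (cos t)^2 - 4 * ?s) * F1 ?s + 4 * ?s * (cos t)^2 * F2 ?s)"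
        by (simp add: power2_eq_square algebra_simps)
      also have "\<dots> = 4 * cos t * ((?s - ?s^2) * F2 ?s + (1/2 - 2 * ?s) * F1 ?s - F ?s / 4)"
        unfolding c2 by (simp add: algebra_simps power2_eq_square)
      finally show ?thesis .
    qed
    also have "\<dots> = - ((2 * a)^2 * y t)"
      unfolding ode[OF s1[OF that]] y_def by (simp add: algebra_simps power2_eq_square)
    finally show ?thesis .
  qed
  \<comment> \<open>Energy of the difference between \<open>y\<close> and \<open>cos (2 a t)\<close>, two solutions of \<open>y'' = -(2 a)\<^sup>2 y\<close>
    with the same initial data.\<close>
  define E where "E t = (y1 t + 2 * a * sin (2 * a * t))^2 + (2 * a)^2 * (y t - cos (2 * a * t))^2" for t
  have dE: "(E has_real_derivative 0) (at t)" if "t \<in> I" for t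
    unfolding E_def[abs_def]
    by (rule derivative_eq_intros refl dy[OF that] dy1[OF that])+ (simp add: algebra_simps power2_eq_square)
  have "\<exists>C. \<forall>t\<in>I. E t = C"
    by (rule has_field_derivative_zero_constant) (auto simp: I_def intro!: DERIV_subset[OF dE])
  moreover have "0 \<in> I" "x \<in> I" using x pi_gt_zero by (auto simp: I_def abs_less_iff)
  ultimately have "E x = E 0" by metis
  also have "E 0 = 0" by (simp add: E_def y_def y1_def F_def eval_fps_at_0 H_def)
  finally have "y x = cos (2 * a * x)"
    using a by (simp add: E_def sum_power2_eq_zero_iff add_nonneg_eq_0_iff)
  thus ?thesis using cpos[OF \<open>x \<in> I\<close>] unfolding y_def F_def H_def hyp2F1_def
    by (simp add: field_simps)
qed

section \<open>The complete elliptic integral of the first kind\<close>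

lemma has_integral_sin_power_even:
  "((\<lambda>x. sin x ^ (2 * n)) has_integral pi * (pochhammer (1/2) n / fact n)) {0..pi}"
proof (induction n)
  case 0
  then show ?case using has_integral_const_real[of "1::real" 0 pi] by simp
next
  case (Suc n)
  \<comment> \<open>The integrand is the derivative of -sin^(2n+1) x cos x, which vanishes at 0 and
    pi; this is the Wallis recurrence (2n+2) I(n+1) = (2n+1) I(n).\<close>
  have "((\<lambda>x. (2 * n + 2) * sin x ^ (2 * Suc n) - (2 * n + 1) * sin x ^ (2 * n)) has_integral
      (- (sin pi ^ (2 * n + 1) * cos pi) - - (sin 0 ^ (2 * n + 1) * cos 0))) {0..pi}"
  proof (rule fundamental_theorem_of_calculus)
    fix x :: real
    have "((\<lambda>x. - (sin x ^ (2 * n + 1) * cos x)) has_real_derivative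
       - ((2 * n + 1) * sin x ^ (2 * n) * (cos x)^2) + sin x ^ (2 * n) * (sin x)^2) (at x within {0..pi})"
      by (rule derivative_eq_intros refl)+ (simp add: power2_eq_square algebra_simps)
    moreover have "- ((2 * n + 1) * sin x ^ (2 * n) * (cos x)^2) + sin x ^ (2 * n) * (sin x)^2
      = (2 * n + 2) * sin x ^ (2 * Suc n) - (2 * n + 1) * sin x ^ (2 * n)"
      unfolding cos_squared_eq by (simp add: algebra_simps power2_eq_square)
    ultimately show "((\<lambda>x. - (sin x ^ (2 * n + 1) * cos x)) has_vector_derivative
       (2 * n + 2) * sin x ^ (2 * Suc n) - (2 * n + 1) * sin x ^ (2 * n)) (at x within {0..pi})"
      by (simp add: has_real_derivative_iff_has_vector_derivative)
  qed auto
  from has_integral_divide[OF has_integral_add[OF this has_integral_mult_right[OF Suc.IH, of "2 * n + 1"]], of "2 * n + 2"]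
  have "((\<lambda>x. sin x ^ (2 * Suc n)) has_integral
    (2 * n + 1) * (pi * (pochhammer (1 / 2) n / fact n)) / (2 * n + 2)) {0..pi}"
    by (simp del: power_Suc mult_Suc_right of_nat_add)
  also have "(2 * n + 1) * (pi * (pochhammer (1 / 2) n / fact n)) / (2 * n + 2)
    = pi * (pochhammer (1 / 2 :: real) (Suc n) / fact (Suc n))"
    by (simp add: pochhammer_Suc divide_simps)
  finally show ?case .
qed

lemma inverse_sqrt_sums:
  fixes x :: real
  assumes "\<bar>x\<bar> < 1"
  shows "(\<lambda>n. pochhammer (1/2) n / fact n * x ^ n) sums (1 / sqrt (1 - x))"
proof -
  have "(\<lambda>n. ((- 1/2) gchoose n) * (- x) ^ n) sums (1 + - x) powr (- 1/2)"
    by (rule gen_binomial_real) (use assms in simp)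
  moreover have "((- 1/2) gchoose n) * (- x) ^ n = pochhammer (1/2) n / fact n * x ^ n" for n
  proof -
    have "(- 1) ^ n * (- x) ^ n = x ^ n" by (simp flip: power_mult_distrib)
    thus ?thesis by (simp add: gbinomial_pochhammer field_simps)
  qed
  moreover have "(1 + - x) powr (- 1/2) = 1 / sqrt (1 - x)"
    using assms by (simp add: powr_minus_divide powr_half_sqrt abs_less_iff)
  ultimately show ?thesis by simp
qed

text \<open>The binomial series in m sin^2 x is dominated by the convergent series of
  \<open>c n * m ^ n\<close>, so it may be integrated termwise. Each term contributes one factor
  \<open>c n\<close> from the binomial series and one from the Wallis integral, whence the squared
  Pochhammer quotient.\<close>

lemma has_integral_elliptic_period:
  fixes m :: real
  assumes m: "0 \<le> m" "m < 1"
  shows "((\<lambda>x. 1 / sqrt (1 - m * (sin x)^2)) has_integral pi * hyp2F1 (1/2) (1/2) 1 m) {0..pi}"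
proof -
  define c :: "nat \<Rightarrow> real" where "c n = pochhammer (1/2) n / fact n" for n
  have c0: "c n \<ge> 0" for n by (simp add: c_def pochhammer_nonneg)
  have sm: "(\<lambda>n. c n * (m * (sin x)^2) ^ n) sums (1 / sqrt (1 - m * (sin x)^2))" for x
  proof -
    have "m * (sin x)^2 \<le> m * 1" by (rule mult_left_mono) (use m in \<open>auto simp: abs_square_le_1\<close>)
    thus ?thesis unfolding c_def by (intro inverse_sqrt_sums) (use m in auto)
  qed
  have ul: "uniform_limit {0..pi} (\<lambda>N x. \<Sum>n<N. c n * (m * (sin x)^2) ^ n) (\<lambda>x. \<Sum>n. c n * (m * (sin x)^2) ^ n) sequentially"
  proof (rule Weierstrass_m_test)
    show "summable (\<lambda>n. c n * m ^ n)"
      using inverse_sqrt_sums[of m] m by (auto simp: c_def dest: sums_summable)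
    fix n x
    have "m * (sin x)^2 \<le> m * 1" by (rule mult_left_mono) (use m in \<open>auto simp: abs_square_le_1\<close>)
    hence "(m * (sin x)^2) ^ n \<le> m ^ n" using m by (intro power_mono) auto
    thus "norm (c n * (m * (sin x)^2) ^ n) \<le> c n * m ^ n"
      using c0[of n] m by (auto simp: abs_mult intro: mult_left_mono)
  qed
  have int: "((\<lambda>x. \<Sum>n<N. c n * (m * (sin x)^2) ^ n) has_integral (\<Sum>n<N. pi * (c n * c n * m ^ n))) {0..pi}" for N
  proof (rule has_integral_sum)
    fix n
    have "(m * (sin x)^2) ^ n = m ^ n * sin x ^ (2 * n)" for x :: real
      by (simp add: power_mult_distrib flip: power_mult)
    with has_integral_mult_right[OF has_integral_sin_power_even, of "c n * m ^ n" n]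
    show "((\<lambda>x. c n * (m * (sin x)^2) ^ n) has_integral pi * (c n * c n * m ^ n)) {0..pi}"
      by (simp add: c_def mult_ac)
  qed auto
  obtain I J where I: "\<And>N. ((\<lambda>x. \<Sum>n<N. c n * (m * (sin x)^2) ^ n) has_integral I N) {0..pi}"
    and J: "((\<lambda>x. \<Sum>n. c n * (m * (sin x)^2) ^ n) has_integral J) {0..pi}"
    and lim: "I \<longlonglongrightarrow> J"
    by (rule uniform_limit_integral[OF ul]) (auto intro!: continuous_intros)
  have "I = (\<lambda>N. \<Sum>n<N. pi * (c n * c n * m ^ n))"
    using I int by (auto intro: has_integral_unique)
  with lim have "(\<lambda>n. pi * (c n * c n * m ^ n)) sums J" by (simp add: sums_def)
  moreover have "(\<lambda>n. c n * c n * m ^ n) sums hyp2F1 (1/2) (1/2) 1 m"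
  proof -
    have "summable (\<lambda>n. fps_nth (fps_hypergeo [1/2, 1/2] [1] 1) n * m ^ n)"
      by (rule summable_fps, rule less_le_trans[OF _ fps_conv_radius_hypergeo]) (use m in simp)
    thus ?thesis unfolding hyp2F1_def eval_fps_def
      by (auto simp: sums_iff c_def simp flip: pochhammer_fact)
  qed
  hence "(\<lambda>n. pi * (c n * c n * m ^ n)) sums (pi * hyp2F1 (1/2) (1/2) 1 m)" by (rule sums_mult)
  ultimately have "J = pi * hyp2F1 (1/2) (1/2) 1 m" by (rule sums_unique2)
  with J sm show ?thesis by (simp add: sums_iff)
qed

section \<open>The germ of \<open>dn3\<close> at the origin\<close>

text \<open>Differentiating \<phi>(f(T)) = T gives \<phi>'(f(T)) h(T) = 1, where \<phi>' is the germ
  of \<open>g\<close>. This removes the local inverse from the rest of the argument.\<close>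

lemma dn3_hyp_sin_integral:
  fixes \<kappa> :: real and g :: "complex \<Rightarrow> complex"
  defines "f \<equiv> hyp_sin_integral \<kappa>"
  defines "h \<equiv> (\<lambda>t. hyp2F1 (1/3) (2/3) (1/2) (of_real (\<kappa>\<^sup>2) * sin t ^ 2))"
  assumes "is_dn3 \<kappa> g"
  shows "\<forall>\<^sub>F T in nhds 0. (f has_field_derivative h T) (at T)"
    and "\<forall>\<^sub>F T in nhds 0. g (f T) * h T = 1"
proof -
  \<comment> \<open>A radius is needed on which the argument of the series stays in the unit disc.
    The ball is convex, so the segment integral defining \<open>f\<close> is a difference of values
    of one primitive \<open>P\<close>.\<close>
  have "isCont (\<lambda>t. norm (complex_of_real (\<kappa>\<^sup>2) * sin t ^ 2)) 0"
    by (intro continuous_intros)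
  hence "((\<lambda>t. norm (complex_of_real (\<kappa>\<^sup>2) * sin t ^ 2)) \<longlongrightarrow> 0) (nhds 0)"
    unfolding isCont_def by (subst tendsto_nhds_iff) simp
  hence "\<forall>\<^sub>F t in nhds 0. norm (complex_of_real (\<kappa>\<^sup>2) * sin t ^ 2) < 1"
    by (rule order_tendstoD) simp
  then obtain r where r: "r > 0" "\<And>t. t \<in> ball 0 r \<Longrightarrow> norm (complex_of_real (\<kappa>\<^sup>2) * sin t ^ 2) < 1"
    unfolding eventually_nhds_metric by (auto simp: dist_commute)
  have holo: "h holomorphic_on ball 0 r"
  proof -
    have "eval_fps (fps_hypergeo [1/3, 2/3] [1/2] 1) holomorphic_on (ball 0 1 :: complex set)"
    proof (rule holomorphic_on_eval_fps)
      show "ball 0 1 \<subseteq> eball 0 (fps_conv_radius (fps_hypergeo [1/3, 2/3] [1/2 :: complex] 1))"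
        by (auto simp: in_eball_iff intro!: less_le_trans[OF _ fps_conv_radius_hypergeo])
    qed
    hence "(\<lambda>t. eval_fps (fps_hypergeo [1/3, 2/3] [1/2] 1) (of_real (\<kappa>\<^sup>2) * sin t ^ 2)) holomorphic_on ball 0 r"
      by (rule holomorphic_on_compose_gen[unfolded o_def, rotated]) (use r in \<open>auto intro!: holomorphic_intros\<close>)
    thus ?thesis by (simp add: h_def hyp2F1_def)
  qed
  then obtain P where P: "\<And>t. t \<in> ball 0 r \<Longrightarrow> (P has_field_derivative h t) (at t within ball 0 r)"
    using holomorphic_convex_primitive'[of "ball 0 r" h] by auto
  have f_eq: "f T = P T - P 0" if "T \<in> ball 0 r" for T
  proof -
    have "closed_segment 0 T \<subseteq> ball 0 r" using that r by (intro closed_segment_subset) auto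
    from contour_integral_primitive[OF P _ this[folded path_image_linepath]]
    show ?thesis unfolding f_def hyp_sin_integral_def h_def[symmetric]
      by (auto intro: contour_integral_unique)
  qed
  have fd: "(f has_field_derivative h T) (at T)" if "T \<in> ball 0 r" for T
  proof -
    have "((\<lambda>T. P T - P 0) has_field_derivative h T) (at T)"
      using P[OF that] at_within_open[OF that] by (auto intro!: derivative_eq_intros)
    thus ?thesis
      by (rule has_field_derivative_transform_within_open[where S = "ball 0 r"])
         (use that f_eq in auto)
  qed
  show "\<forall>\<^sub>F T in nhds 0. (f has_field_derivative h T) (at T)"
    using eventually_nhds_in_open[of "ball 0 r" 0] r fd by (auto elim: eventually_mono)
  from assms(3) obtain \<phi> where \<phi>: "\<phi> analytic_on {0}" "\<forall>\<^sub>F T in nhds 0. \<phi> (f T) = T"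
    "\<forall>\<^sub>F u in nhds 0. g u = deriv \<phi> u"
    unfolding is_dn3_def local_inverse_at_0_def f_def by blast
  have "isCont f 0" using fd[of 0] r DERIV_isCont by auto
  moreover have f0: "f 0 = 0" using f_eq[of 0] r by simp
  ultimately have lim: "filterlim f (nhds 0) (nhds 0)"
    by (simp add: isCont_def tendsto_nhds_iff)
  from \<phi>(1) obtain S where S: "open S" "0 \<in> S" "\<phi> holomorphic_on S"
    by (auto simp: analytic_at)
  hence "\<forall>\<^sub>F u in nhds 0. u \<in> S" by (intro eventually_nhds_in_open)
  hence "\<forall>\<^sub>F u in nhds 0. \<phi> field_differentiable at u"
    by eventually_elim (use S in \<open>auto intro: holomorphic_on_imp_differentiable_at\<close>)
  note ev = eventually_compose_filterlim[OF this lim] eventually_compose_filterlim[OF \<phi>(3) lim]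
  have "\<forall>\<^sub>F T in nhds 0. T \<in> ball 0 r" by (rule eventually_nhds_in_open) (use r in auto)
  \<comment> \<open>Differentiating at T needs the inverse identity on a whole neighbourhood of T,
    hence the iterated filter statement.\<close>
  moreover have "\<forall>\<^sub>F T in nhds 0. \<forall>\<^sub>F T' in nhds T. \<phi> (f T') = T'"
    using \<phi>(2) by (subst eventually_eventually)
  ultimately show "\<forall>\<^sub>F T in nhds 0. g (f T) * h T = 1"
    using ev
  proof eventually_elim
    case (elim T)
    have "(\<phi> has_field_derivative deriv \<phi> (f T)) (at (f T))"
      using elim by (simp add: field_differentiable_derivI)
    from DERIV_chain2[OF this fd]
    have "((\<lambda>T. \<phi> (f T)) has_field_derivative deriv \<phi> (f T) * h T) (at T)" using elim by simp
    moreover have "((\<lambda>T. \<phi> (f T)) has_field_derivative 1) (at T)"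
      by (rule DERIV_cong_ev[THEN iffD2, OF refl _ refl DERIV_ident]) (use elim in auto)
    ultimately show ?case using elim DERIV_unique by auto
  qed
qed

text \<open>With s = sin y, the cubic is sin 3y, and \<open>hyp2F1_sin_sq\<close> with a = -1/6
  gives cos y / cos 3y. The bound on s is what keeps 3y inside (-pi/2, pi/2).\<close>

lemma hyp2F1_sin_cubic:
  fixes s :: real
  assumes "\<bar>s\<bar> < 1 / 2"
  shows "hyp2F1 (1/3) (2/3) (1/2) ((3 * s - 4 * s ^ 3)^2) = 1 / (1 - 4 * s^2)"
proof -
  define y where "y = arcsin s"
  have s: "s = sin y" using assms by (simp add: y_def)
  have "\<bar>y\<bar> < pi / 6"
  proof -
    have "arcsin (1/2) = pi / 6"
      by (rule arcsin_unique) (auto simp: sin_30)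
    moreover have "arcsin s < arcsin (1/2)" "arcsin (-(1/2)) < arcsin s"
      by (rule arcsin_less_arcsin; use assms in linarith)+
    ultimately show ?thesis unfolding y_def using arcsin_minus[of "1/2"] by linarith
  qed
  hence y: "\<bar>3 * y\<bar> < pi / 2" by linarith
  have "3 * s - 4 * s ^ 3 = sin (3 * y)"
  proof -
    have "sin (3 * y) = sin (2 * y + y)" by simp
    also have "\<dots> = 3 * s - 4 * s ^ 3"
      unfolding sin_add sin_double cos_double_sin s using cos_squared_eq[of y] by algebra
    finally show ?thesis ..
  qed
  moreover have "hyp2F1 (1/2 + (- 1/6)) (1/2 - (- 1/6)) (1/2) ((sin (3 * y))^2) = cos (2 * (- 1/6) * (3 * y)) / cos (3 * y)"
    by (rule hyp2F1_sin_sq) (use y in auto)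
  moreover have "cos (3 * y) = cos y * (1 - 4 * s^2)"
    unfolding cos_treble_cos s using cos_squared_eq[of y] by algebra
  moreover have "cos y > 0" using y by (intro cos_gt_zero_pi) auto
  ultimately show ?thesis by simp
qed

section \<open>Identity principles for meromorphic functions\<close>

text \<open>On a connected open set a meromorphic function either vanishes off a sparse set or
  avoids 0 off a sparse set; zeros accumulating at one point rule out the second case.\<close>

lemma meromorphic_eventually_0_of_frequently_0:
  assumes "f meromorphic_on A" "open A" "connected A"
    and "z \<in> A" "\<exists>\<^sub>F w in at z. f w = 0" and "x \<in> A"
  shows "\<forall>\<^sub>F w in at x. f w = 0"
proof -
  have "\<not> (\<forall>\<^sub>F w in at z. f w \<noteq> 0)" using assms(5) by (simp add: frequently_def)
  hence "\<not> (\<forall>\<^sub>\<approx>w\<in>A. f w \<noteq> 0)" using assms by (auto simp: eventually_cosparse_open_eq)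
  thus ?thesis
    using meromorphic_imp_constant_or_avoid[OF assms(1-3), of 0] assms by (auto simp: eventually_cosparse_open_eq)
qed

text \<open>The punctured germ decides whether there is a pole and what the limit is otherwise, and
  the convention of value 0 at poles then fixes the value at the point.\<close>

lemma nicely_meromorphic_on_eqI:
  assumes "f nicely_meromorphic_on {z}" "g nicely_meromorphic_on {z}" "\<forall>\<^sub>F w in at z. f w = g w"
  shows "f z = g z"
proof -
  have "is_pole f z \<longleftrightarrow> is_pole g z"
    using assms(3) unfolding is_pole_def by (rule filterlim_cong[OF refl refl])
  moreover have "(f \<longlongrightarrow> l) (at z) \<longleftrightarrow> (g \<longlongrightarrow> l) (at z)" for l
    using assms(3) by (rule filterlim_cong[OF refl refl])
  ultimately show ?thesis using assms(1,2) unfolding nicely_meromorphic_on_def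
    by (metis LIM_unique at_neq_bot insertI1 is_pole_def not_tendsto_and_filterlim_at_infinity)
qed

lemma nicely_meromorphic_on_shift:
  assumes "f nicely_meromorphic_on UNIV"
  shows "(\<lambda>z. f (p + z)) nicely_meromorphic_on UNIV"
  unfolding nicely_meromorphic_on_def
proof (intro conjI ballI)
  show "(\<lambda>z. f (p + z)) meromorphic_on UNIV"
    by (rule meromorphic_on_compose[where A = UNIV])
       (use assms in \<open>auto simp: nicely_meromorphic_on_def intro!: analytic_intros\<close>)
  fix z
  show "is_pole (\<lambda>z. f (p + z)) z \<and> f (p + z) = 0 \<or> (\<lambda>z. f (p + z)) \<midarrow>z\<rightarrow> f (p + z)"
    using assms filterlim_shift_iff[of f p _ "p + z"] unfolding nicely_meromorphic_on_def is_pole_def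
    by (auto simp: o_def)
qed

text \<open>The squared norm of sin z is at most cosh^2 (Im z), and \<open>q\<close> is m cosh^2. As
  q(0) = m < 1, continuity gives a strip on which the radicand has positive real part, so the
  principal square root is holomorphic there.\<close>

lemma sin_squared_strip:
  fixes m :: real
  assumes "0 \<le> m" "m < 1"
  shows "\<exists>\<delta>>0. \<forall>z. \<bar>Im z\<bar> < \<delta> \<longrightarrow> Re (1 - of_real m * sin z ^ 2) > 0"
proof -
  define q where "q y = m * ((exp (2 * y) + inverse (exp (2 * y)) + 2) / 4)" for y :: real
  have "isCont q 0" unfolding q_def[abs_def] by (intro continuous_intros) auto
  hence "(q \<longlongrightarrow> q 0) (nhds 0)" by (simp add: isCont_def tendsto_nhds_iff)
  hence "\<forall>\<^sub>F y in nhds 0. q y < 1"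
    by (rule order_tendstoD) (use assms in \<open>simp add: q_def\<close>)
  then obtain \<delta> where \<delta>: "\<delta> > 0" "\<And>y. \<bar>y\<bar> < \<delta> \<Longrightarrow> q y < 1"
    unfolding eventually_nhds_metric by (auto simp: dist_real_def)
  have "Re (1 - of_real m * sin z ^ 2) > 0" if "\<bar>Im z\<bar> < \<delta>" for z
  proof -
    have le: "(x + y - 2 * c) / 4 \<le> (x + y + 2) / 4" if "- 1 \<le> c" for x y c :: real
      using that by simp
    have "norm (of_real m * sin z ^ 2) = m * norm (sin z) ^ 2" using assms by (simp add: norm_mult norm_power)
    also have "\<dots> \<le> q (Im z)"
      unfolding norm_sin_squared q_def by (intro mult_left_mono assms le cos_ge_minus_one)
    also have "\<dots> < 1" by (rule \<delta>) (rule that)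
    finally have "Re (of_real m * sin z ^ 2) < 1" using complex_Re_le_cmod le_less_trans by blast
    thus ?thesis by simp
  qed
  thus ?thesis using \<delta>(1) by blast
qed

text \<open>Lets an identity known only along a real curve supply the accumulating zeros that the
  identity principle asks for.\<close>

lemma frequently_filterlim:
  assumes "filterlim f G F" "F \<noteq> bot" "\<forall>\<^sub>F x in F. P (f x)"
  shows "\<exists>\<^sub>F x in G. P x"
  unfolding frequently_def
proof
  assume "\<forall>\<^sub>F x in G. \<not> P x"
  hence "\<forall>\<^sub>F x in F. \<not> P (f x)" using assms(1) by (rule eventually_compose_filterlim)
  with assms(3) have "\<forall>\<^sub>F x in F. False" by eventually_elim simp
  thus False using assms(2) by simp
qed

section \<open>Legendre's substitution for the quartic (1 - x)(x - b)(x - c)(x - d)\<close>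

locale quartic_roots =
  fixes \<kappa> b c d :: real
  assumes kappa: "0 < \<kappa>"
    and order: "d < c" "c < b" "b < 1"
    and cubic: "\<And>x. x ^ 3 + 3 * x^2 - 4 * (1 - \<kappa>^2) = (x - b) * (x - c) * (x - d)"
begin

text \<open>\<open>modulus\<close> is a cross-ratio of the roots 1, b, c, d and turns out to be k^2;
  \<open>speed\<close> is 3/(2M), since M is half the root of (1 - c)(b - d).\<close>

definition "modulus = (1 - b) * (c - d) / ((1 - c) * (b - d))"
definition "speed = 3 / sqrt ((1 - c) * (b - d))"

text \<open>The Moebius transform of \<open>s = sin\<^sup>2 z\<close> sending \<open>s = 0, 1, 1/modulus, \<infinity>\<close> to the roots \<open>1, b, c, d\<close>.\<close>
definition dn_param :: "'a::{real_normed_field,banach} \<Rightarrow> 'a" where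
  "dn_param z = 1 - of_real ((1 - b) * (1 - d)) * sin z ^ 2 / (of_real (b - d) + of_real (1 - b) * sin z ^ 2)"

lemma modulus_bounds: "0 < modulus" "modulus < 1"
proof -
  \<comment> \<open>The three-term relation between cross-ratios: it exhibits 1 -
    \<open>modulus\<close> as a quotient of positive quantities.\<close>
  have "(1 - c) * (b - d) - (1 - b) * (c - d) = (1 - d) * (b - c)" by algebra
  moreover have "(1 - d) * (b - c) > 0" "(1 - c) * (b - d) > 0" "(1 - b) * (c - d) > 0" using order by auto
  ultimately show "0 < modulus" "modulus < 1" by (auto simp: modulus_def)
qed

lemma denominator_pos: "b - d + (1 - b) * (sin t)^2 > 0"
  using order by (intro add_pos_nonneg mult_nonneg_nonneg) auto

text \<open>Both f(p(t)) and u(t) vanish at 0 and have the same derivative, so they agree near 0,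
  and the germ identity for \<open>g\<close> applies at T = p(t). The primitive \<open>u\<close> is
  arbitrary so that the real restriction of a holomorphic one can be inserted later.\<close>

lemma dn3_param_near_0:
  assumes g: "is_dn3 \<kappa> g"
    and u0: "u 0 = 0" and u: "\<And>t. (u has_real_derivative speed / sqrt (1 - modulus * (sin t)^2)) (at t)"
  shows "\<forall>\<^sub>F t in nhds 0. g (of_real (u t)) = of_real (dn_param t)"
proof -
  define f where "f = hyp_sin_integral \<kappa>"
  define h :: "complex \<Rightarrow> complex" where "h = (\<lambda>t. hyp2F1 (1/3) (2/3) (1/2) (of_real (\<kappa>\<^sup>2) * sin t ^ 2))"
  have fh: "\<forall>\<^sub>F T in nhds 0. (f has_field_derivative h T) (at T)" "\<forall>\<^sub>F T in nhds 0. g (f T) * h T = 1"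
    unfolding f_def h_def by (rule dn3_hyp_sin_integral[OF g])+
  define D where "D t = b - d + (1 - b) * (sin t)^2" for t
  \<comment> \<open>The chain of substitutions: \<open>\<sigma>\<close> is sin (\<psi>/3),
    \<open>w\<close> is sin \<psi> by the triple-angle formula, and \<open>p\<close> is the
    amplitude with \<kappa> sin p = sin \<psi>. The constant \<open>C\<close> makes 1 - 4
    \<open>\<sigma>\<close>^2 equal to \<open>dn_param\<close>.\<close>
  define C where "C = sqrt ((1 - b) * (1 - d)) / 2"
  define \<sigma> where "\<sigma> t = C * sin t / sqrt (D t)" for t
  define w where "w t = 3 * \<sigma> t - 4 * \<sigma> t ^ 3" for t
  define p where "p t = arcsin (w t / \<kappa>)" for t
  define \<sigma>' where "\<sigma>' t = C * cos t * (b - d) / (D t * sqrt (D t))" for t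
  have Dpos: "D t > 0" for t unfolding D_def by (rule denominator_pos)
  have C2: "C^2 = (1 - b) * (1 - d) / 4" using order by (simp add: C_def power_divide)
  have Cpos: "C > 0" using order by (simp add: C_def)
  have X: "dn_param t = 1 - 4 * \<sigma> t ^ 2" for t
  proof -
    have "4 * \<sigma> t ^ 2 = (1 - b) * (1 - d) * (sin t)^2 / D t"
      using Dpos[of t] by (simp add: \<sigma>_def power_divide power_mult_distrib C2)
    thus ?thesis by (simp add: dn_param_def D_def)
  qed
  have d\<sigma>: "(\<sigma> has_real_derivative \<sigma>' t) (at t)" for t
  proof -
    have "(\<sigma> has_real_derivative (C * cos t * sqrt (D t) - C * sin t * ((1 - b) * (2 * sin t * cos t) * (inverse (sqrt (D t)) / 2))) / (sqrt (D t) * sqrt (D t))) (at t)"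
      unfolding \<sigma>_def[abs_def] D_def
      by (rule derivative_eq_intros refl | use denominator_pos[of t] in \<open>simp add: algebra_simps\<close>)+
    also have "C * cos t * sqrt (D t) - C * sin t * ((1 - b) * (2 * sin t * cos t) * (inverse (sqrt (D t)) / 2))
       = C * cos t * (sqrt (D t) * sqrt (D t) - (1 - b) * (sin t)^2) / sqrt (D t)"
      using Dpos[of t] by (simp add: field_simps power2_eq_square)
    also have "sqrt (D t) * sqrt (D t) - (1 - b) * (sin t)^2 = b - d" using Dpos[of t] by (simp add: D_def)
    finally show ?thesis using Dpos[of t] by (simp add: \<sigma>'_def mult.commute)
  qed
  \<comment> \<open>With \<open>x = 1 - 4 \<sigma>\<^sup>2\<close>, the left-hand side is \<open>(x - b) (x - c) (x - d) / 4\<close>.\<close>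
  have key: "\<kappa>^2 - w t ^ 2 = \<sigma>' t ^ 2 * ((1 - c) * (b - d) * (1 - modulus * (sin t)^2))" for t
  proof -
    let ?X = "1 - 4 * \<sigma> t ^ 2"
    let ?s = "(sin t)^2"
    have D: "D t = b - d + (1 - b) * ?s" by (simp add: D_def)
    have nz: "D t \<noteq> 0" "1 - c \<noteq> 0" "b - d \<noteq> 0" using Dpos[of t] order by auto
    have \<sigma>2: "4 * \<sigma> t ^ 2 = (1 - b) * (1 - d) * ?s / D t"
      using Dpos[of t] by (simp add: \<sigma>_def power_divide power_mult_distrib C2)
    have c2: "(cos t)^2 = 1 - ?s" by (rule cos_squared_eq)
    have "4 * (\<kappa>^2 - w t ^ 2) = ?X ^ 3 + 3 * ?X^2 - 4 * (1 - \<kappa>^2)"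
      unfolding w_def by algebra
    also have "\<dots> = (?X - b) * (?X - c) * (?X - d)" by (rule cubic)
    also have "?X - b = (1 - b) * (b - d) * (1 - ?s) / D t"
      unfolding \<sigma>2 using nz by (simp add: divide_simps) (simp add: D algebra_simps)
    also have "?X - d = (1 - d) * (b - d) / D t"
      unfolding \<sigma>2 using nz by (simp add: divide_simps) (simp add: D algebra_simps)
    also have "?X - c = (1 - c) * (b - d) * (1 - modulus * ?s) / D t"
    proof -
      have m: "modulus * ((1 - c) * (b - d)) = (1 - b) * (c - d)" using nz by (simp add: modulus_def)
      have "(1 - c) * (b - d) * (1 - modulus * ?s) = (1 - c) * (b - d) - (1 - b) * (c - d) * ?s"
        using m by algebra
      thus ?thesis unfolding \<sigma>2 using nz by (simp add: divide_simps) (simp add: D algebra_simps)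
    qed
    also have "(1 - b) * (b - d) * (1 - ?s) / D t * ((1 - c) * (b - d) * (1 - modulus * ?s) / D t) * ((1 - d) * (b - d) / D t)
      = 4 * (\<sigma>' t ^ 2 * ((1 - c) * (b - d) * (1 - modulus * ?s)))"
    proof -
      have eq: "4 * \<sigma>' t ^ 2 = (1 - b) * (1 - d) * (1 - ?s) * (b - d)^2 / ((D t)^2 * D t)"
        using Dpos[of t] by (simp add: \<sigma>'_def power_divide power_mult_distrib C2 c2)
      show ?thesis
        unfolding mult.assoc[symmetric, of 4] eq by (simp add: power2_eq_square mult_ac)
    qed
    finally show ?thesis by simp
  qed
  have cont: "isCont \<sigma> 0" "isCont w 0" "isCont p 0"
  proof -
    show 1: "isCont \<sigma> 0" by (rule DERIV_isCont[OF d\<sigma>])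
    thus 2: "isCont w 0" unfolding w_def[abs_def] by (intro continuous_intros)
    have "w 0 = 0" by (simp add: w_def \<sigma>_def)
    hence "isCont arcsin (w 0 / \<kappa>)" by (simp add: isCont_arcsin)
    thus "isCont p 0" unfolding p_def[abs_def]
      by (rule isCont_o2[where f = "\<lambda>t. w t / \<kappa>" and g = arcsin, rotated])
         (use 2 kappa in \<open>auto intro!: continuous_intros\<close>)
  qed
  have lim: "(\<sigma> \<longlongrightarrow> 0) (nhds 0)" "(w \<longlongrightarrow> 0) (nhds 0)" "(p \<longlongrightarrow> 0) (nhds 0)" "(cos \<longlongrightarrow> cos (0::real)) (nhds 0)"
  proof -
    have *: "(q \<longlongrightarrow> q 0) (nhds 0)" if "isCont q 0" for q :: "real \<Rightarrow> real"
      using that by (simp add: isCont_def tendsto_nhds_iff)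
    show "(\<sigma> \<longlongrightarrow> 0) (nhds 0)" "(w \<longlongrightarrow> 0) (nhds 0)" "(p \<longlongrightarrow> 0) (nhds 0)"
      using *[OF cont(1)] *[OF cont(2)] *[OF cont(3)] by (simp_all add: p_def w_def \<sigma>_def)
    show "(cos \<longlongrightarrow> cos (0::real)) (nhds 0)" by (rule *) auto
  qed
  have limp: "filterlim (\<lambda>t. complex_of_real (p t)) (nhds 0) (nhds 0)"
    using tendsto_of_real[OF lim(3), where ?'a = complex] by simp
  \<comment> \<open>The four bounds serve, in order, the cubic evaluation of the hypergeometric
    function, differentiability of arcsin at w/\<kappa>, convergence of the series at w^2, and the
    sign of \<open>\<sigma>'\<close>.\<close>
  have small: "\<forall>\<^sub>F t in nhds 0. \<bar>\<sigma> t\<bar> < 1/2 \<and> \<bar>w t\<bar> < \<kappa> \<and> \<bar>w t\<bar> < 1 \<and> cos t > 0"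
    using order_tendstoD(2)[OF tendsto_rabs[OF lim(1)], of "1/2"] order_tendstoD(2)[OF tendsto_rabs[OF lim(2)], of \<kappa>]
      order_tendstoD(2)[OF tendsto_rabs[OF lim(2)], of 1] order_tendstoD(1)[OF lim(4), of 0] kappa
    by (auto intro!: eventually_conj)
  have hp: "h (of_real (p t)) = of_real (1 / dn_param t)" if "\<bar>\<sigma> t\<bar> < 1/2" "\<bar>w t\<bar> < \<kappa>" "\<bar>w t\<bar> < 1" for t
  proof -
    have "sin (p t) = w t / \<kappa>" unfolding p_def using that kappa by (intro sin_arcsin) (auto simp: divide_simps abs_less_iff)
    hence "\<kappa>^2 * sin (p t) ^ 2 = w t ^ 2" using kappa by (simp add: power_divide)
    hence *: "of_real (\<kappa>\<^sup>2) * sin (complex_of_real (p t)) ^ 2 = of_real (w t ^ 2)"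
      by (metis of_real_mult of_real_power sin_of_real)
    have "h (of_real (p t)) = of_real (hyp2F1 (1/3) (2/3) (1/2) (w t ^ 2))"
      unfolding h_def * using hyp2F1_of_real[of "w t ^ 2" "1/3" "2/3" "1/2", where ?'a = complex] that
      by (simp add: abs_square_less_1)
    also have "hyp2F1 (1/3) (2/3) (1/2) (w t ^ 2) = 1 / dn_param t"
      unfolding w_def X by (rule hyp2F1_sin_cubic) (rule that)
    finally show ?thesis .
  qed
  \<comment> \<open>The derivative of \<open>p\<close> carries a factor \<open>dn_param t\<close>,
    which cancels against h(p(t)) = 1 / \<open>dn_param t\<close>; only the elliptic integrand
    remains.\<close>
  have dp: "((\<lambda>t. f (of_real (p t))) has_vector_derivative of_real (speed / sqrt (1 - modulus * (sin t)^2))) (at t)"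
    if t: "\<bar>\<sigma> t\<bar> < 1/2" "\<bar>w t\<bar> < \<kappa>" "\<bar>w t\<bar> < 1" "cos t > 0"
      "(f has_field_derivative h (of_real (p t))) (at (of_real (p t)))" for t
  proof -
    have dw: "(w has_real_derivative 3 * \<sigma>' t * dn_param t) (at t)"
      unfolding w_def[abs_def] X
      by (rule derivative_eq_intros refl d\<sigma>)+ (simp add: algebra_simps power2_eq_square)
    have "\<sigma>' t > 0" using t Cpos order Dpos[of t] by (simp add: \<sigma>'_def)
    have "((\<lambda>t. w t / \<kappa>) has_real_derivative 3 * \<sigma>' t * dn_param t / \<kappa>) (at t)"
      by (rule DERIV_cdivide[OF dw])
    from DERIV_chain2[where f = arcsin and g = "\<lambda>t. w t / \<kappa>", OF DERIV_arcsin this]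
    have "(p has_real_derivative inverse (sqrt (1 - (w t / \<kappa>)^2)) * (3 * \<sigma>' t * dn_param t / \<kappa>)) (at t)"
      unfolding p_def[abs_def] using t kappa by (simp add: divide_simps abs_less_iff)
    also have "inverse (sqrt (1 - (w t / \<kappa>)^2)) * (3 * \<sigma>' t * dn_param t / \<kappa>) = 3 * \<sigma>' t * dn_param t / sqrt (\<kappa>^2 - w t ^ 2)"
    proof -
      have "\<kappa>^2 - w t ^ 2 = \<kappa>^2 * (1 - (w t / \<kappa>)^2)" using kappa by (simp add: field_simps)
      hence "sqrt (\<kappa>^2 - w t ^ 2) = \<kappa> * sqrt (1 - (w t / \<kappa>)^2)" using kappa by (simp add: real_sqrt_mult)
      thus ?thesis by (simp add: divide_inverse mult_ac)
    qed
    \<comment> \<open>Taking the square root of \<open>key\<close> is where positivity of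
      \<open>\<sigma>'\<close> enters; \<open>\<sigma>'\<close> then cancels from the
      quotient.\<close>
    also have "sqrt (\<kappa>^2 - w t ^ 2) = \<sigma>' t * (sqrt ((1 - c) * (b - d)) * sqrt (1 - modulus * (sin t)^2))"
      unfolding key using \<open>\<sigma>' t > 0\<close> by (simp add: real_sqrt_mult)
    also have "3 * \<sigma>' t * dn_param t / \<dots> = speed / sqrt (1 - modulus * (sin t)^2) * dn_param t"
      using \<open>\<sigma>' t > 0\<close> by (simp add: speed_def)
    finally have p': "(p has_real_derivative speed / sqrt (1 - modulus * (sin t)^2) * dn_param t) (at t)" .
    have "dn_param t \<noteq> 0" using t(1) abs_square_less_1[of "2 * \<sigma> t"] by (auto simp: X power_mult_distrib abs_mult)
    with field_vector_diff_chain_at[OF has_vector_derivative_of_real[OF p'] t(5)] hp[OF t(1-3)]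
    show ?thesis by (simp add: o_def)
  qed
  from eventually_compose_filterlim[OF fh(1) limp] small
  have "\<forall>\<^sub>F t in nhds 0. ((\<lambda>t. f (of_real (p t)) - of_real (u t)) has_vector_derivative 0) (at t)"
  proof eventually_elim
    case (elim t)
    from has_vector_derivative_diff[OF dp has_vector_derivative_of_real[OF u]] elim show ?case by simp
  qed
  then obtain e where e: "e > 0" "\<And>t. \<bar>t\<bar> < e \<Longrightarrow> ((\<lambda>t. f (of_real (p t)) - of_real (u t)) has_vector_derivative 0) (at t)"
    unfolding eventually_nhds_metric by (auto simp: dist_real_def)
  have "((\<lambda>t. f (of_real (p t)) - of_real (u t)) has_vector_derivative 0) (at t within {-e<..<e})"
    if "t \<in> {-e<..<e}" for t
    by (rule has_vector_derivative_at_within, rule e(2)) (use that in \<open>simp add: abs_less_iff\<close>)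
  from has_vector_derivative_zero_constant[OF convex_real_interval(8) this]
  obtain k where k: "\<And>t. t \<in> {-e<..<e} \<Longrightarrow> f (of_real (p t)) - of_real (u t) = k"
    by blast
  have "f 0 = 0" by (simp add: f_def hyp_sin_integral_def)
  hence "k = 0" using k[of 0] e by (simp add: p_def w_def \<sigma>_def u0)
  have "\<forall>\<^sub>F t in nhds 0. t \<in> {-e<..<e}" by (rule eventually_nhds_in_open) (use e in auto)
  with eventually_compose_filterlim[OF fh(2) limp] small
  show ?thesis
  proof eventually_elim
    case (elim t)
    hence "f (of_real (p t)) = of_real (u t)" using k \<open>k = 0\<close> by simp
    with elim hp[of t] show ?case by (auto simp: field_simps)
  qed
qed

lemma modulus_sin_squared_less: "modulus * (sin t)^2 < 1"
proof -
  have "modulus * (sin t)^2 \<le> modulus * 1"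
    using modulus_bounds by (intro mult_left_mono) (auto simp: abs_square_le_1)
  thus ?thesis using modulus_bounds by linarith
qed

lemma speed_pos: "speed > 0"
  using order by (simp add: speed_def)

lemma dn_param_of_real: "dn_param (of_real t) = of_real (dn_param t)"
  by (simp add: dn_param_def sin_of_real)

lemma isCont_dn_param: "isCont dn_param (complex_of_real t)"
proof -
  have "of_real (b - d) + of_real (1 - b) * sin (complex_of_real t) ^ 2 = of_real (b - d + (1 - b) * (sin t)^2)"
    by (simp add: sin_of_real)
  also have "\<dots> \<noteq> 0" using denominator_pos[of t] by (simp only: of_real_eq_0_iff)
  finally show ?thesis unfolding dn_param_def[abs_def] by (intro continuous_intros)
qed

section \<open>Continuation along the real axis and the fundamental period\<close>

text \<open>The local primitive extends holomorphically to a strip as \<open>U\<close>, so the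
  identity near 0 propagates to the strip off a sparse set. Real points, where \<open>g\<close>
  might a priori have a pole, are then handled by limits.\<close>

lemma dn3_real_param:
  assumes g: "is_dn3 \<kappa> g"
  obtains u where "u 0 = 0" "\<And>t. (u has_real_derivative speed / sqrt (1 - modulus * (sin t)^2)) (at t)"
    "\<And>t. g (of_real (u t)) = of_real (dn_param t)"
proof -
  obtain \<delta> where \<delta>: "\<delta> > 0" "\<And>z. \<bar>Im z\<bar> < \<delta> \<Longrightarrow> Re (1 - of_real modulus * sin z ^ 2) > 0"
    using sin_squared_strip[of modulus] modulus_bounds by auto
  define S where "S = {z. Im z < \<delta>} \<inter> {z. Im z > - \<delta>}"
  have S: "open S" "convex S" "of_real t \<in> S" for t
    using \<delta>(1) by (auto simp: S_def intro!: open_Int open_halfspace_Im_lt open_halfspace_Im_gt convex_Int convex_halfspace_Im_lt convex_halfspace_Im_gt)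
  define v where "v z = of_real speed / csqrt (1 - of_real modulus * sin z ^ 2)" for z
  have nonneg: "1 - of_real modulus * sin z ^ 2 \<notin> \<real>\<^sub>\<le>\<^sub>0" if "z \<in> S" for z
    using \<delta>(2)[of z] that by (auto simp: S_def complex_nonpos_Reals_iff abs_less_iff)
  have "v holomorphic_on S"
    unfolding v_def[abs_def] by (intro holomorphic_intros nonneg) (use nonneg in force)+
  then obtain P where P: "\<And>z. z \<in> S \<Longrightarrow> (P has_field_derivative v z) (at z within S)"
    using holomorphic_convex_primitive'[OF S(2,1)] by blast
  define U where "U z = P z - P 0" for z
  have dU: "(U has_field_derivative v z) (at z)" if "z \<in> S" for z
    unfolding U_def[abs_def] using P[OF that] at_within_open[OF that S(1)] by (auto intro!: derivative_eq_intros)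
  define u where "u t = Re (U (of_real t))" for t
  have v_real: "v (of_real t) = of_real (speed / sqrt (1 - modulus * (sin t)^2))" for t
  proof -
    have "csqrt (1 - of_real modulus * sin (of_real t) ^ 2) = csqrt (of_real (1 - modulus * (sin t)^2))"
      by (simp add: sin_of_real)
    also have "\<dots> = of_real (sqrt (1 - modulus * (sin t)^2))"
      by (rule csqrt_of_real) (use modulus_sin_squared_less[of t] in simp)
    finally show ?thesis by (simp add: v_def)
  qed
  have dUr: "((\<lambda>t. U (of_real t)) has_vector_derivative of_real (speed / sqrt (1 - modulus * (sin t)^2))) (at t)" for t
    using has_vector_derivative_real_field[OF dU[OF S(3)]] by (simp add: v_real)
  have du: "(u has_real_derivative speed / sqrt (1 - modulus * (sin t)^2)) (at t)" for t
    using bounded_linear.has_vector_derivative[OF bounded_linear_Re dUr]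
    by (simp add: u_def[abs_def] has_real_derivative_iff_has_vector_derivative)
  \<comment> \<open>The integrand is real on the axis and U(0) = 0, so \<open>U\<close> is real
    there and agrees with its real part \<open>u\<close>.\<close>
  have "((\<lambda>t. Im (U (of_real t))) has_real_derivative 0) (at t)" for t
    using bounded_linear.has_vector_derivative[OF bounded_linear_Im dUr]
    by (simp add: has_real_derivative_iff_has_vector_derivative)
  hence "Im (U (of_real t)) = Im (U (of_real 0))" for t
    by (intro DERIV_isconst_all[where f = "\<lambda>t. Im (U (of_real t))"]) auto
  hence Uu: "U (of_real t) = of_real (u t)" for t by (simp add: complex_eq_iff u_def U_def)
  have u0: "u 0 = 0" by (simp add: u_def U_def)
  have nice: "g nicely_meromorphic_on UNIV" using g by (simp add: is_dn3_def elliptic_def)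
  have mero: "(\<lambda>z. g (U z) - dn_param z) meromorphic_on S"
  proof (intro meromorphic_intros)
    have "U holomorphic_on S" using dU S(1) by (auto simp: holomorphic_on_open)
    hence "U analytic_on S" using S(1) by (simp add: analytic_on_open)
    moreover have "g meromorphic_on UNIV" using nice unfolding nicely_meromorphic_on_def by blast
    ultimately show "(\<lambda>z. g (U z)) meromorphic_on S" by (metis meromorphic_on_compose subset_UNIV)
    show "dn_param meromorphic_on S"
      unfolding dn_param_def[abs_def] by (intro meromorphic_intros analytic_on_imp_meromorphic_on analytic_intros)
  qed
  have freq: "\<exists>\<^sub>F z in at 0. g (U z) - dn_param z = 0"
  proof (rule frequently_filterlim[where F = "at (0::real)" and f = complex_of_real])
    show "filterlim complex_of_real (at 0) (at 0)"
      by (auto simp: filterlim_at eventually_at_filter intro!: tendsto_eq_intros)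
    show "\<forall>\<^sub>F t in at 0. g (U (complex_of_real t)) - dn_param (complex_of_real t) = 0"
      using dn3_param_near_0[OF g u0 du] by (auto simp: eventually_at_filter Uu dn_param_of_real elim: eventually_mono)
  qed auto
  have near: "\<forall>\<^sub>F z in at (of_real t). g (U z) - dn_param z = 0" for t
    by (rule meromorphic_eventually_0_of_frequently_0[OF mero S(1) convex_connected[OF S(2)] _ freq S(3)])
       (use S(3)[of 0] in simp)
  have "g (of_real (u t)) = of_real (dn_param t)" for t
  proof -
    have "((\<lambda>z. g (U z)) \<longlongrightarrow> dn_param (of_real t)) (at (of_real t)) \<longleftrightarrow> (dn_param \<longlongrightarrow> dn_param (of_real t)) (at (complex_of_real t))"
      by (rule filterlim_cong[OF refl refl]) (use near in \<open>auto elim: eventually_mono\<close>)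
    hence lim: "((\<lambda>z. g (U z)) \<longlongrightarrow> dn_param (of_real t)) (at (of_real t))"
      using isCont_dn_param[of t] by (simp add: isCont_def)
    have limU: "(U \<longlongrightarrow> of_real (u t)) (at (of_real t))"
      using DERIV_isCont[OF dU[OF S(3)], of t] by (simp add: isCont_def Uu)
    \<comment> \<open>A nonzero derivative means that \<open>U\<close> misses the value u(t) on a
      punctured neighbourhood of t. Limits of \<open>g\<close> at u(t) can therefore be pulled back
      through \<open>U\<close>: a pole there would contradict the finite limit of the composition,
      so \<open>g\<close> is continuous at u(t).\<close>
    have "((\<lambda>z. (U z - U (of_real t)) / (z - of_real t)) \<longlongrightarrow> v (of_real t)) (at (of_real t))"
      using dU[OF S(3)] by (simp add: has_field_derivative_iff)
    moreover have "v (of_real t) \<noteq> 0"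
      using speed_pos modulus_sin_squared_less[of t] by (simp add: v_real)
    ultimately have "\<forall>\<^sub>F z in at (of_real t). (U z - U (of_real t)) / (z - of_real t) \<noteq> 0"
      by (rule tendsto_imp_eventually_ne)
    hence ne: "\<forall>\<^sub>F z in at (of_real t). U z \<noteq> of_real (u t)"
      by eventually_elim (auto simp: Uu)
    have "\<not> is_pole g (of_real (u t))"
      using is_pole_compose[OF _ limU ne, of g] lim not_tendsto_and_filterlim_at_infinity[OF at_neq_bot lim]
      by (auto simp: is_pole_def)
    hence "(g \<longlongrightarrow> g (of_real (u t))) (at (of_real (u t)))"
      using nice by (auto simp: nicely_meromorphic_on_def)
    hence "((\<lambda>z. g (U z)) \<longlongrightarrow> g (of_real (u t))) (at (of_real t))"
      by (rule filterlim_compose) (use limU ne in \<open>auto simp: filterlim_at\<close>)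
    from tendsto_unique[OF at_neq_bot this lim] show ?thesis by (simp add: dn_param_of_real)
  qed
  with u0 du show thesis by (rule that)
qed

text \<open>Since sin^2 has period pi, u(pi) is a positive real period and hence at least 2K.
  Conversely 2K = u(t) for some t in (0, pi], and g(2K) = g(0) = 1 forces sin t = 0, so t =
  pi.\<close>

lemma dn3_fundamental_real_period:
  fixes K K' :: real
  assumes g: "is_dn3 \<kappa> g" and K: "K > 0"
    and periods: "periods g = {of_int (2 * m) * of_real K + of_int (2 * n) * (\<i> * of_real K') | m n :: int. True}"
  shows "2 * K = speed * pi * hyp2F1 (1/2) (1/2) 1 modulus"
proof -
  from dn3_real_param[OF g] obtain u where u: "u 0 = 0"
    "\<And>t. (u has_real_derivative speed / sqrt (1 - modulus * (sin t)^2)) (at t)"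
    "\<And>t. g (of_real (u t)) = of_real (dn_param t)" by blast
  have "((\<lambda>t. speed / sqrt (1 - modulus * (sin t)^2)) has_integral u pi - u 0) {0..pi}"
    using u(2) by (intro fundamental_theorem_of_calculus)
      (auto intro: DERIV_subset simp flip: has_real_derivative_iff_has_vector_derivative)
  moreover have "((\<lambda>t. speed * (1 / sqrt (1 - modulus * (sin t)^2))) has_integral speed * (pi * hyp2F1 (1/2) (1/2) 1 modulus)) {0..pi}"
    by (intro has_integral_mult_right has_integral_elliptic_period) (use modulus_bounds in auto)
  ultimately have upi: "u pi = speed * pi * hyp2F1 (1/2) (1/2) 1 modulus"
    by (auto simp: u(1) dest: has_integral_unique)
  have dpos: "speed / sqrt (1 - modulus * (sin t)^2) > 0" for t
    using speed_pos modulus_sin_squared_less[of t] by simp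
  have mono: "u s < u t" if "s < t" for s t
    using that by (rule DERIV_pos_imp_increasing) (use u(2) dpos in blast)
  have shift: "u (pi + t) = u pi + u t" for t
  proof -
    have "((\<lambda>t. u (pi + t) - u t) has_real_derivative 0) (at t)" for t
    proof -
      have "((\<lambda>t. u (pi + t)) has_real_derivative speed / sqrt (1 - modulus * (sin (pi + t))^2)) (at t)"
        using DERIV_shift[of u _ t pi] u(2)[of "pi + t"] by (simp add: add.commute)
      from DERIV_diff[OF this u(2)[of t]] show ?thesis by simp
    qed
    hence "u (pi + t) - u t = u (pi + 0) - u 0" by (intro DERIV_isconst_all[where f = "\<lambda>t. u (pi + t) - u t"]) auto
    thus ?thesis by (simp add: u(1))
  qed
  have nice: "g nicely_meromorphic_on UNIV" using g by (simp add: is_dn3_def elliptic_def)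
  define G where "G z = g (of_real (u pi) + z)" for z
  have niceG: "G nicely_meromorphic_on UNIV" unfolding G_def[abs_def] by (rule nicely_meromorphic_on_shift[OF nice])
  \<comment> \<open>By \<open>shift\<close> and the period pi of \<open>dn_param\<close>,
    \<open>G\<close> and \<open>g\<close> agree at every u(t). Approaching from the right and using
    strict monotonicity makes these points nonzero and convergent to 0.\<close>
  have "\<exists>\<^sub>F z in at 0. G z - g z = 0"
  proof (rule frequently_filterlim[where F = "at_right (0::real)" and f = "\<lambda>t. complex_of_real (u t)"])
    have "isCont u 0" by (rule DERIV_isCont[OF u(2)])
    hence "(u \<longlongrightarrow> 0) (at_right 0)" by (auto simp: isCont_def u(1) intro: tendsto_within_subset)
    from tendsto_of_real[OF this, where ?'a = complex]
    have "((\<lambda>t. complex_of_real (u t)) \<longlongrightarrow> 0) (at_right 0)" by simp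
    moreover have "\<forall>\<^sub>F t in at_right 0. complex_of_real (u t) \<noteq> 0"
      using eventually_at_right_less[of 0] by eventually_elim (use mono[of 0] u(1) in force)
    ultimately show "filterlim (\<lambda>t. complex_of_real (u t)) (at 0) (at_right 0)"
      by (simp add: filterlim_at)
    have "G (of_real (u t)) = g (of_real (u t))" for t
      using u(3)[of "pi + t"] u(3)[of t] by (simp add: G_def shift dn_param_def)
    thus "\<forall>\<^sub>F t in at_right 0. G (complex_of_real (u t)) - g (complex_of_real (u t)) = 0" by simp
  qed auto
  hence "\<forall>\<^sub>F w in at z. G w - g w = 0" for z
    by (rule meromorphic_eventually_0_of_frequently_0[where A = UNIV, rotated 4])
       (use nice niceG in \<open>auto simp only: nicely_meromorphic_on_def open_UNIV connected_UNIV UNIV_I intro!: meromorphic_on_diff\<close>)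
  hence "G z = g z" for z
    by (intro nicely_meromorphic_on_eqI nicely_meromorphic_on_subset[OF nice] nicely_meromorphic_on_subset[OF niceG])
       (auto elim: eventually_mono)
  hence "of_real (u pi) \<in> periods g" by (simp add: periods_def G_def add.commute)
  then obtain m n :: int where mn: "of_real (u pi) = of_int (2 * m) * of_real K + of_int (2 * n) * (\<i> * of_real K')"
    unfolding periods by blast
  \<comment> \<open>The second generator is purely imaginary, so the real part isolates an integer
    multiple of 2K, and positivity of u(pi) makes the integer at least 1.\<close>
  from arg_cong[OF this, of Re] have m: "u pi = of_int (2 * m) * K" by simp
  have "u pi > 0" using mono[of 0 pi] by (simp add: u(1))
  hence "m \<ge> 1" using K by (simp add: m zero_less_mult_iff)
  hence "1 * K \<le> of_int m * K" using K by (intro mult_right_mono) auto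
  hence ge: "2 * K \<le> u pi" by (simp add: m)
  have "of_real (2 * K) \<in> periods g"
    unfolding periods by (rule CollectI, rule exI[of _ 1], rule exI[of _ 0]) simp
  hence "g (0 + of_real (2 * K)) = g 0" unfolding periods_def by blast
  also have "g 0 = 1" using u(3)[of 0] by (simp add: u(1) dn_param_def)
  finally have gK: "g (of_real (2 * K)) = 1" by simp
  have "\<exists>t. 0 \<le> t \<and> t \<le> pi \<and> u t = 2 * K"
    by (rule IVT') (use u(1) K ge in \<open>auto intro!: continuous_at_imp_continuous_on DERIV_isCont[OF u(2)]\<close>)
  then obtain t where t: "0 \<le> t" "t \<le> pi" "u t = 2 * K" by blast
  have "complex_of_real (dn_param t) = of_real 1" using u(3)[of t] gK by (simp only: t(3)) simp
  hence "dn_param t = 1" by (simp only: of_real_eq_iff)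
  hence "sin t = 0" using order denominator_pos[of t] by (simp add: dn_param_def)
  moreover have "t > 0" using t K u(1) by (cases "t = 0") auto
  ultimately have "t = pi" using t sin_gt_zero[of t] by fastforce
  with t upi show ?thesis by simp
qed

end

section \<open>Trigonometric form of the roots and of the constants\<close>

theorem theorem8:
  fixes \<kappa> lam \<theta> M k K K' :: real and dn3 :: "complex \<Rightarrow> complex"
  assumes "0 < \<kappa>" "\<kappa> < 1" "0 < lam" "lam < 1" "\<kappa>\<^sup>2 + lam\<^sup>2 = 1"
    and "0 < \<theta>" "\<theta> < pi / 6" "lam = cos (3 * \<theta>)"
    and "M > 0" "M\<^sup>2 = 2 * sqrt 3 * (cos (\<theta> + pi / 6))\<^sup>2 * cos (2 * \<theta> - pi / 6)"
    and "k\<^sup>2 = (sin \<theta>)\<^sup>2 * sin (2 * \<theta>) / ((cos (\<theta> + pi / 6))\<^sup>2 * cos (2 * \<theta> - pi / 6))"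
    and "is_dn3 \<kappa> dn3"
    and "K > 0" "K' > 0"
    and "periods dn3 = {of_int (2 * m) * of_real K + of_int (2 * n) * (\<i> * of_real K') | m n :: int. True}"
  shows "2 * K = 3 * pi / (2 * M) * hyp2F1 (1/2) (1/2) 1 (k\<^sup>2)"
proof -
  define C where "C = cos (2 * \<theta>)"
  define S where "S = sin (2 * \<theta>)"
  \<comment> \<open>With x = 2 cos \<alpha> - 1 the cubic equation becomes cos 3\<alpha> = cos
    6\<theta>. The choices \<alpha> = 2\<theta>, 2\<theta> - 2 pi/3, 2\<theta> + 2 pi/3 give
    \<open>b\<close>, \<open>c\<close>, \<open>d\<close>.\<close>
  define b where "b = 2 * C - 1"
  define c where "c = - C + sqrt 3 * S - 1"
  define d where "d = - C - sqrt 3 * S - 1"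
  have CS: "C^2 + S^2 = 1" by (simp add: C_def S_def)
  have s3: "sqrt 3 ^ 2 = (3::real)" by simp
  have dist: "2 * r * (x * (r / 2) + y * (1 / 2)) = r^2 * x + r * y"
    "2 * r * (x * (r / 2) - y * (1 / 2)) = r^2 * x - r * y" for r x y :: real
    by (simp_all add: power2_eq_square algebra_simps)
  have sin2: "4 * (sin \<theta>)^2 = 1 - b"
    unfolding b_def C_def cos_double_sin by simp
  have cos2: "4 * (cos (\<theta> + pi / 6))^2 = 1 - c"
  proof -
    have "4 * (cos (\<theta> + pi / 6))^2 = 2 * cos (2 * (\<theta> + pi / 6)) + 2" unfolding cos_double_cos by simp
    also have "2 * (\<theta> + pi / 6) = 2 * \<theta> + pi / 3" by simp
    also have "2 * cos (2 * \<theta> + pi / 3) + 2 = 1 - c" unfolding cos_add cos_60 sin_60 c_def C_def S_def by simp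
    finally show ?thesis .
  qed
  have cosm: "2 * sqrt 3 * cos (2 * \<theta> - pi / 6) = b - d"
    unfolding cos_diff cos_30 sin_30 b_def d_def C_def S_def dist s3 by simp
  have sin2t: "2 * sqrt 3 * sin (2 * \<theta>) = c - d"
    by (simp add: c_def d_def S_def)
  have order: "d < c" "c < b" "b < 1"
  proof -
    have "sin (2 * \<theta>) > 0" using assms by (intro sin_gt_zero) auto
    thus "d < c" using sin2t by (smt (verit) mult_pos_pos real_sqrt_gt_zero)
    have "sin \<theta> > 0" using assms by (intro sin_gt_zero) auto
    thus "b < 1" using sin2 by (smt (verit) zero_less_power)
    \<comment> \<open>The difference b - c is 2 sqrt 3 times this cosine; the bound \<theta> < pi/6
      puts its angle below pi/2.\<close>
    have "cos (2 * \<theta> + pi / 6) > 0" using assms by (intro cos_gt_zero) auto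
    moreover have "2 * sqrt 3 * cos (2 * \<theta> + pi / 6) = b - c"
      unfolding cos_add cos_30 sin_30 b_def c_def C_def S_def dist s3 by simp
    ultimately show "c < b" by (smt (verit) mult_pos_pos real_sqrt_gt_zero)
  qed
  interpret quartic_roots \<kappa> b c d
  proof
    fix x :: real
    \<comment> \<open>Two expansions of cos 6\<theta>, as a double angle in 3\<theta> and as a
      triple angle in 2\<theta>, express the constant term of the cubic through
      \<open>C\<close>.\<close>
    have "2 * lam^2 = cos (2 * (3 * \<theta>)) + 1" unfolding assms(8) cos_double_cos by simp
    also have "2 * (3 * \<theta>) = 3 * (2 * \<theta>)" by simp
    also have "cos (3 * (2 * \<theta>)) = 4 * C ^ 3 - 3 * C" unfolding C_def by (rule cos_treble_cos)
    finally have "4 * (1 - \<kappa>^2) = 8 * C ^ 3 - 6 * C + 2" using assms(5) by algebra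
    moreover have "(x - b) * (x - c) * (x - d) = (x - b) * ((x + C + 1)^2 - sqrt 3 ^ 2 * S^2)"
      unfolding c_def d_def by algebra
    moreover have "S^2 = 1 - C^2" using CS by simp
    ultimately show "x ^ 3 + 3 * x^2 - 4 * (1 - \<kappa>^2) = (x - b) * (x - c) * (x - d)"
      unfolding b_def s3 by algebra
  qed (use assms order in auto)
  have "4 * M^2 = (4 * (cos (\<theta> + pi / 6))^2) * (2 * sqrt 3 * cos (2 * \<theta> - pi / 6))"
    unfolding assms(10) by simp
  hence "(2 * M)^2 = (1 - c) * (b - d)" unfolding cos2 cosm by (simp add: power_mult_distrib)
  hence "sqrt ((1 - c) * (b - d)) = 2 * M" using assms(9) by (intro real_sqrt_unique) auto
  hence "speed = 3 / (2 * M)" by (simp add: speed_def)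
  \<comment> \<open>Numerator and denominator are both scaled by 8 sqrt 3, so that every factor
    becomes a difference of two roots of the quartic.\<close>
  moreover have "k^2 = (4 * (sin \<theta>)^2) * (2 * sqrt 3 * sin (2 * \<theta>)) /
      ((4 * (cos (\<theta> + pi / 6))^2) * (2 * sqrt 3 * cos (2 * \<theta> - pi / 6)))"
    unfolding assms(11) by simp
  hence "k^2 = modulus" unfolding sin2 cos2 cosm sin2t modulus_def .
  ultimately show ?thesis
    using dn3_fundamental_real_period[OF assms(12,13,15)] by simp
qed

end
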